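(* Let $\Delta t>0$, let $n\in\mathbb{N}$ with $n\ge 1$, and let a space-time block have temporal interval $[(n-1)\Delta t,n\Delta t]$ and spatial domain $\Omega\subset\mathbb{R}^M$. Let $\{p_j^{(n)}\}_{j\ge 0}$ be a polynomial basis on the temporal interval and $\{q_{\mathbf{k}}\}$ a polynomial basis on $\Omega$. Suppose that, on this block, we have $$u(t,\mathbf{x})=\sum_{j,\mathbf{k}}u_{j,\mathbf{k}}\,p_j^{(n)}(t)\,q_{\mathbf{k}}(\mathbf{x}).$$ Then the final time slice of this block has the spatial-basis representation $$u(n\Delta t,\mathbf{x})=\sum_{\mathbf{k}}\Bigl(\sum_j u_{j,\mathbf{k}}\,p_j^{(n)}(n\Delta t)\Bigr)q_{\mathbf{k}}(\mathbf{x}).$$ In particular, if $p_j^{(n)}(t)=\tilde P_j^{(a,b),n}(t)$ are the shifted Jacobi polynomials with $a,b>-1$, then $$u(n\Delta t,\mathbf{x})=\sum_{\mathbf{k}}\Bigl(\sum_j\binom{j+a}{j}u_{j,\mathbf{k}}\Bigr)q_{\mathbf{k}}(\mathbf{x})=\sum_{\mathbf{k}}\Bigl(\sum_j\frac{(a+1)_j}{j!}\,u_{j,\mathbf{k}}\Bigr)q_{\mathbf{k}}(\mathbf{x}).$$ In particular, the weights multiplying $u_{j,\mathbf{k}}$ in the last display are independent of the block index $n$ and of the step size $\Delta t$.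
   Context: The expansions are truncated (finite sums), with coefficients $u_{j,\mathbf{k}}$, time index $j\ge 0$ and spatial (multi-)index $\mathbf{k}$. $P_j^{(a,b)}$ denotes the degree-$j$ Jacobi polynomial on $[-1,1]$ in the standard (DLMF) normalisation. The shifted Jacobi polynomials on the block are $\tilde P_j^{(a,b),n}(t)=P_j^{(a,b)}(m_n(t))$, where $m_n(t)=\frac{2t-(2n-1)\Delta t}{\Delta t}$ is the affine bijection of $[(n-1)\Delta t,n\Delta t]$ onto $[-1,1]$. $(a+1)_j=(a+1)(a+2)\cdots(a+j)$ is the Pochhammer symbol (rising factorial), and $\binom{j+a}{j}=\frac{\Gamma(j+a+1)}{\Gamma(j+1)\Gamma(a+1)}$. *)

theory Defs
  imports "HOL-Analysis.Analysis" "HOL-Computational_Algebra.Polynomial"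
begin

text \<open>
  A family \<open>f\<close>, indexed by \<open>K\<close>, is a polynomial basis on \<open>S\<close> if its restrictions to \<open>S\<close> form
  a (Hamel) basis of the space of all real polynomial functions restricted to \<open>S\<close>.
  On \<open>real ^ 'm\<close>, \<^const>\<open>real_polynomial_function\<close> describes the multivariate polynomials.
\<close>
definition polynomial_basis_on ::
    "'k set \<Rightarrow> ('k \<Rightarrow> 'a::real_normed_vector \<Rightarrow> real) \<Rightarrow> 'a set \<Rightarrow> bool" where
  "polynomial_basis_on K f S \<longleftrightarrow>
     (\<forall>k\<in>K. real_polynomial_function (f k)) \<and>
     (\<forall>F c. finite F \<longrightarrow> F \<subseteq> K \<longrightarrow> (\<forall>x\<in>S. (\<Sum>k\<in>F. c k * f k x) = 0) \<longrightarrow> (\<forall>k\<in>F. c k = 0)) \<and>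
     (\<forall>g. real_polynomial_function g \<longrightarrow>
        (\<exists>F c. finite F \<and> F \<subseteq> K \<and> (\<forall>x\<in>S. g x = (\<Sum>k\<in>F. c k * f k x))))"

text \<open>
  The defining properties of the Jacobi polynomials in the DLMF (Table 18.3.1): \<open>P j\<close> has degree
  \<open>j\<close>, the family is orthogonal on \<open>(-1, 1)\<close> for the weight \<open>(1 - x)\<^sup>a (1 + x)\<^sup>b\<close>, and the
  normalisation is fixed by the leading coefficient \<open>(j + a + b + 1)\<^sub>j / (2\<^sup>j j!)\<close>.  For
  \<open>a, b > -1\<close> this determines the family uniquely; the endpoints of the integration interval
  form a null set, so the values of \<open>powr\<close> there are immaterial.
\<close>
definition is_jacobi_family :: "real \<Rightarrow> real \<Rightarrow> (nat \<Rightarrow> real poly) \<Rightarrow> bool" where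
  "is_jacobi_family a b P \<longleftrightarrow>
     (\<forall>j. degree (P j) = j) \<and>
     (\<forall>i j. i \<noteq> j \<longrightarrow>
        ((\<lambda>x. (1 - x) powr a * (1 + x) powr b * (poly (P i) x * poly (P j) x))
           has_integral 0) {-1..1}) \<and>
     (\<forall>j. lead_coeff (P j) = pochhammer (real j + a + b + 1) j / (2 ^ j * fact j))"

definition jacobi_poly :: "real \<Rightarrow> real \<Rightarrow> nat \<Rightarrow> real poly" where
  "jacobi_poly a b = (THE P. is_jacobi_family a b P)"

definition block_map :: "real \<Rightarrow> nat \<Rightarrow> real \<Rightarrow> real" where
  "block_map \<Delta>t n t = (2 * t - (2 * real n - 1) * \<Delta>t) / \<Delta>t"

definition shifted_jacobi :: "real \<Rightarrow> real \<Rightarrow> real \<Rightarrow> nat \<Rightarrow> nat \<Rightarrow> real \<Rightarrow> real" where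
  "shifted_jacobi a b \<Delta>t n j t = poly (jacobi_poly a b j) (block_map \<Delta>t n t)"

end

theory Submission
  imports Defs
begin

text \<open>
  The final time is mapped to \<open>1\<close> by \<^const>\<open>block_map\<close>, so everything reduces to the value of the
  Jacobi polynomials at \<open>1\<close>.  As \<^const>\<open>jacobi_poly\<close> is given by a definite description, the family
  has to be constructed: it is \<open>(a+1)\<^sub>j / j! \<cdot> \<^sub>2F\<^sub>1(-j, j+a+b+1; a+1; (1-x)/2)\<close>, whose value at \<open>1\<close> is
  the constant coefficient.  Orthogonality follows since, by the hypergeometric equation, the
  integrand is up to the factor \<open>\<lambda>\<^sub>i - \<lambda>\<^sub>j \<noteq> 0\<close> the derivative of
  \<open>(1-x)\<^bsup>a+1\<^esup> (1+x)\<^bsup>b+1\<^esup>\<close> times a Wronskian, which vanishes at both endpoints.  Uniqueness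
  holds because the difference of two candidates of degree \<open>j\<close> has smaller degree and hence is
  orthogonal to itself.
\<close>

section \<open>Hypergeometric form of the Jacobi polynomials\<close>

definition jacobi_coeff :: "real \<Rightarrow> real \<Rightarrow> nat \<Rightarrow> nat \<Rightarrow> real" where
  "jacobi_coeff a b j k = pochhammer (a + 1) j / fact j *
     (pochhammer (- real j) k * pochhammer (real j + a + b + 1) k / (pochhammer (a + 1) k * fact k))"

text \<open>The variable here is y = (1 - x)/2, in which the coefficients obey a two-term
  recurrence; \<open>jacobi_explicit\<close> returns to x.\<close>

definition jacobi_hyp :: "real \<Rightarrow> real \<Rightarrow> nat \<Rightarrow> real poly" where
  "jacobi_hyp a b j = (\<Sum>k\<le>j. monom (jacobi_coeff a b j k) k)"

definition jacobi_explicit :: "real \<Rightarrow> real \<Rightarrow> nat \<Rightarrow> real poly" where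
  "jacobi_explicit a b j = pcompose (jacobi_hyp a b j) [:1/2, -1/2:]"

text \<open>For k > j the factor \<open>pochhammer (- real j) k\<close> vanishes, so truncating the
  series at j loses nothing and the formula needs no bound on k.\<close>

lemma coeff_jacobi_hyp: "coeff (jacobi_hyp a b j) k = jacobi_coeff a b j k"
proof (cases "k \<le> j")
  case True
  then show ?thesis
    by (simp add: jacobi_hyp_def coeff_sum)
next
  case False
  then have "pochhammer (- real j) k = 0"
    by (intro pochhammer_of_nat_eq_0_lemma) simp
  with False show ?thesis
    by (simp add: jacobi_hyp_def coeff_sum jacobi_coeff_def)
qed

text \<open>This is the term ratio of the hypergeometric series with denominators cleared; a > -1
  keeps them nonzero.\<close>

lemma jacobi_coeff_Suc:
  assumes "a > -1"
  shows "(real k + 1) * (real k + a + 1) * jacobi_coeff a b j (Suc k) =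
    (real k - real j) * (real k + real j + a + b + 1) * jacobi_coeff a b j k"
proof -
  define X where "X = pochhammer (a + 1) k"
  define Y where "Y = pochhammer (- real j) k"
  define Z where "Z = pochhammer (real j + a + b + 1) k"
  define c where "c = pochhammer (a + 1) j / fact j"
  define f :: real where "f = fact k"
  have "X > 0" unfolding X_def using assms by (intro pochhammer_pos) simp
  moreover have "f > 0" by (simp add: f_def)
  moreover have "real k + a + 1 > 0" using assms by simp
  moreover have k: "jacobi_coeff a b j k = c * (Y * Z / (X * f))"
    by (simp add: jacobi_coeff_def X_def Y_def Z_def c_def f_def)
  moreover have Suc_k: "jacobi_coeff a b j (Suc k) = c * ((Y * (real k - real j)) *
     (Z * (real k + real j + a + b + 1)) / ((X * (real k + a + 1)) * ((real k + 1) * f)))"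
    by (simp add: jacobi_coeff_def X_def Y_def Z_def c_def f_def pochhammer_Suc algebra_simps)
  ultimately show ?thesis
    unfolding k Suc_k by (simp add: divide_simps)
qed

text \<open>Gauss's hypergeometric equation with parameters -j, j+a+b+1 and a+1: comparing the
  coefficients of y^k gives exactly the recurrence above.\<close>

lemma jacobi_hyp_ode:
  fixes a b y :: real and j :: nat
  assumes "a > -1"
  defines "H \<equiv> jacobi_hyp a b j"
  shows "y * (1 - y) * poly (pderiv (pderiv H)) y + (a + 1 - (a + b + 2) * y) * poly (pderiv H) y +
    real j * (real j + a + b + 1) * poly H y = 0"
proof -
  have "[:0, 1, -1:] * pderiv (pderiv H) + [:a + 1, - (a + b + 2):] * pderiv H +
    smult (real j * (real j + a + b + 1)) H = 0" (is "?L = 0")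
  proof (rule poly_eqI)
    fix k
    have rec: "(real k + 1) * (real k + a + 1) * coeff H (Suc k) =
        (real k - real j) * (real k + real j + a + b + 1) * coeff H k"
      using jacobi_coeff_Suc[OF assms(1)] by (simp add: H_def coeff_jacobi_hyp)
    have "coeff ?L k = (real k + 1) * (real k + a + 1) * coeff H (Suc k) -
        (real k - real j) * (real k + real j + a + b + 1) * coeff H k"
      \<comment> \<open>Multiplication by y - y^2 shifts indices by one and two, so k = 0, k = 1 and
        k >= 2 are treated separately.\<close>
      by (cases k; cases "k - 1") (simp_all add: coeff_pderiv coeff_pCons algebra_simps)
    then show "coeff ?L k = coeff 0 k"
      using rec by simp
  qed
  then have "poly ?L y = 0" by simp
  then show ?thesis by (simp add: algebra_simps)
qed

text \<open>For j = 0 the base a+b+1 may be negative, but the product is empty; for j >= 1 the base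
  is positive.\<close>

lemma pochhammer_jacobi_lead_pos:
  fixes a b :: real
  assumes "a > -1" "b > -1"
  shows "pochhammer (real j + a + b + 1) j > 0"
  using assms by (cases "j = 0") (auto intro!: pochhammer_pos)

lemma jacobi_coeff_top:
  assumes "a > -1"
  shows "jacobi_coeff a b j j = (-1) ^ j * pochhammer (real j + a + b + 1) j / fact j"
proof -
  have "pochhammer (a + 1) j > 0"
    using assms by (intro pochhammer_pos) simp
  then show ?thesis
    by (simp add: jacobi_coeff_def pochhammer_same)
qed

lemma degree_jacobi_hyp:
  assumes "a > -1" "b > -1"
  shows "degree (jacobi_hyp a b j) = j"
proof (rule antisym)
  show "degree (jacobi_hyp a b j) \<le> j"
    unfolding jacobi_hyp_def by (intro degree_sum_le) (auto intro: order.trans[OF degree_monom_le])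
  have "coeff (jacobi_hyp a b j) j \<noteq> 0"
    using pochhammer_jacobi_lead_pos[OF assms, of j]
    by (simp add: coeff_jacobi_hyp jacobi_coeff_top[OF assms(1)])
  then show "j \<le> degree (jacobi_hyp a b j)"
    by (rule le_degree)
qed

lemma degree_jacobi_explicit:
  assumes "a > -1" "b > -1"
  shows "degree (jacobi_explicit a b j) = j"
  by (simp add: jacobi_explicit_def degree_pcompose degree_jacobi_hyp[OF assms])

lemma lead_coeff_jacobi_explicit:
  assumes "a > -1" "b > -1"
  shows "lead_coeff (jacobi_explicit a b j) = pochhammer (real j + a + b + 1) j / (2 ^ j * fact j)"
proof -
  have "lead_coeff (jacobi_explicit a b j) = jacobi_coeff a b j j * (-1/2) ^ j"
    unfolding jacobi_explicit_def
    by (subst lead_coeff_comp) (simp_all add: degree_jacobi_hyp[OF assms] coeff_jacobi_hyp)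
  also have "\<dots> = pochhammer (real j + a + b + 1) j / fact j * ((-1) * (-1/2)) ^ j"
    unfolding jacobi_coeff_top[OF assms(1)] power_mult_distrib by simp
  finally show ?thesis
    by (simp add: power_divide)
qed

lemma poly_jacobi_explicit_1: "poly (jacobi_explicit a b j) 1 = pochhammer (a + 1) j / fact j"
  by (simp add: jacobi_explicit_def poly_pcompose poly_0_coeff_0 coeff_jacobi_hyp jacobi_coeff_def)

section \<open>Orthogonality\<close>

lemma jacobi_explicit_orthogonal:
  assumes ab: "a > -1" "b > -1" and "i \<noteq> j"
  shows "((\<lambda>x. (1 - x) powr a * (1 + x) powr b *
    (poly (jacobi_explicit a b i) x * poly (jacobi_explicit a b j) x)) has_integral 0) {-1..1}"
proof -
  define f where "f = jacobi_hyp a b i"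
  define g where "g = jacobi_hyp a b j"
  define ev where "ev m = real m * (real m + a + b + 1)" for m
  define y :: "real \<Rightarrow> real" where "y x = (1 - x) / 2" for x
  define v where "v x = (1 - x) powr (a + 1) * (1 + x) powr (b + 1)" for x
  define w where "w x = (1 - x) powr a * (1 + x) powr b" for x
  define W where "W = pderiv f * g - f * pderiv g"
  \<comment> \<open>The 2 combines the 4 in 1 - x^2 = 4y(1 - y) with dy/dx = -1/2.\<close>
  define \<kappa> where "\<kappa> = 2 * (ev i - ev j)"
  have "ev i - ev j = (real i - real j) * (real i + real j + a + b + 1)"
    by (simp add: ev_def algebra_simps)
  \<comment> \<open>Together with a + b > -2 this makes the second factor positive.\<close>
  moreover have "real i + real j \<ge> 1" using \<open>i \<noteq> j\<close> by linarith
  ultimately have "\<kappa> \<noteq> 0"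
    using \<open>i \<noteq> j\<close> ab by (simp add: \<kappa>_def)
  have "((\<lambda>x. \<kappa> * (w x * (poly f (y x) * poly g (y x)))) has_integral
      (v 1 * poly W (y 1) - v (-1) * poly W (y (-1)))) {-1..1}"
  \<comment> \<open>For negative a or b the weight blows up towards an endpoint. The antiderivative
    is still continuous there, its exponents a+1 and b+1 being positive, so derivatives are taken
    only in the interior.\<close>
  proof (rule fundamental_theorem_of_calculus_interior)
    show "continuous_on {-1..1} (\<lambda>x. v x * poly W (y x))"
      using ab unfolding v_def y_def
      by (intro continuous_intros continuous_on_powr') auto
    fix x :: real
    assume x: "x \<in> {-1<..<1}"
    define z where "z = y x"
    have y': "(y has_field_derivative (- 1 / 2)) (at x)"
      unfolding y_def by (auto intro!: derivative_eq_intros)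
    have v_eq: "v x = w x * (4 * z * (1 - z))"
      using x by (simp add: v_def w_def z_def y_def powr_add field_simps)
    have "((\<lambda>x. (1 - x) powr (a + 1)) has_field_derivative (a + 1) * (1 - x) powr a * - 1) (at x)"
      using x has_real_derivative_powr[of "1 - x" "a + 1"]
      by (intro DERIV_chain2[where f = "\<lambda>t. t powr (a + 1)" and g = "\<lambda>x. 1 - x"])
        (auto intro!: derivative_eq_intros)
    moreover have "((\<lambda>x. (1 + x) powr (b + 1)) has_field_derivative (b + 1) * (1 + x) powr b * 1) (at x)"
      using x has_real_derivative_powr[of "1 + x" "b + 1"]
      by (intro DERIV_chain2[where f = "\<lambda>t. t powr (b + 1)" and g = "\<lambda>x. 1 + x"])
        (auto intro!: derivative_eq_intros)
    ultimately have "(v has_field_derivative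
        (-(a + 1) * (1 - x) powr a * (1 + x) powr (b + 1) +
          (1 - x) powr (a + 1) * ((b + 1) * (1 + x) powr b))) (at x)"
      unfolding v_def by (rule DERIV_cong[OF DERIV_mult]) (simp add: algebra_simps)
    \<comment> \<open>Pearson's equation: up to the factor -2 w, the derivative of \<open>v\<close>
      is the first-order coefficient of the hypergeometric equation.\<close>
    also have "-(a + 1) * (1 - x) powr a * (1 + x) powr (b + 1) +
          (1 - x) powr (a + 1) * ((b + 1) * (1 + x) powr b) =
        w x * (- 2 * (a + 1 - (a + b + 2) * z))"
      using x by (simp add: w_def z_def y_def powr_add field_simps)
    finally have v': "(v has_field_derivative \<dots>) (at x)" .
    have W': "((\<lambda>x. poly W (y x)) has_field_derivative (poly (pderiv W) z * (- 1 / 2))) (at x)"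
      unfolding z_def by (rule DERIV_chain2[OF poly_DERIV y'])
    have W'': "poly (pderiv W) z =
        poly (pderiv (pderiv f)) z * poly g z - poly f z * poly (pderiv (pderiv g)) z"
      by (simp add: W_def pderiv_diff pderiv_mult algebra_simps)
    have f0: "z * (1 - z) * poly (pderiv (pderiv f)) z =
        - (a + 1 - (a + b + 2) * z) * poly (pderiv f) z - ev i * poly f z"
      using jacobi_hyp_ode[OF ab(1), of z b i] by (simp add: f_def ev_def algebra_simps)
    have g0: "z * (1 - z) * poly (pderiv (pderiv g)) z =
        - (a + 1 - (a + b + 2) * z) * poly (pderiv g) z - ev j * poly g z"
      using jacobi_hyp_ode[OF ab(1), of z b j] by (simp add: g_def ev_def algebra_simps)
    have "v x * (poly (pderiv W) z * (- 1 / 2)) + w x * (- 2 * (a + 1 - (a + b + 2) * z)) * poly W z =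
        - 2 * w x * ((z * (1 - z) * poly (pderiv (pderiv f)) z) * poly g z
          - poly f z * (z * (1 - z) * poly (pderiv (pderiv g)) z)
          + (a + 1 - (a + b + 2) * z) * poly W z)"
      unfolding W'' v_eq by (simp add: algebra_simps)
    also have "\<dots> = \<kappa> * (w x * (poly f z * poly g z))"
      unfolding f0 g0 by (simp add: W_def \<kappa>_def algebra_simps)
    finally have eq: "w x * (- 2 * (a + 1 - (a + b + 2) * z)) * poly W z +
        poly (pderiv W) z * (- 1 / 2) * v x = \<kappa> * (w x * (poly f z * poly g z))"
      by (simp add: algebra_simps)
    show "((\<lambda>x. v x * poly W (y x)) has_vector_derivative
        \<kappa> * (w x * (poly f (y x) * poly g (y x)))) (at x)"
      using DERIV_mult[OF v' W'] eq
      by (simp add: has_real_derivative_iff_has_vector_derivative z_def)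
  qed simp
  moreover have "v 1 = 0" "v (-1) = 0" by (simp_all add: v_def)
  ultimately have "((\<lambda>x. \<kappa> * (w x * (poly f (y x) * poly g (y x)))) has_integral 0) {-1..1}"
    by simp
  from has_integral_mult_right[OF this, of "1 / \<kappa>"] \<open>\<kappa> \<noteq> 0\<close>
  show ?thesis
    by (simp add: jacobi_explicit_def poly_pcompose f_def g_def w_def y_def diff_divide_distrib)
qed

lemma is_jacobi_family_explicit:
  assumes "a > -1" "b > -1"
  shows "is_jacobi_family a b (jacobi_explicit a b)"
  unfolding is_jacobi_family_def
  using degree_jacobi_explicit[OF assms] jacobi_explicit_orthogonal[OF assms]
    lead_coeff_jacobi_explicit[OF assms]
  by blast

section \<open>Uniqueness of the Jacobi family\<close>

text \<open>Induction on the degree m of d: subtracting a multiple of \<open>P m\<close> cancels the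
  leading term, and \<open>P m\<close> is orthogonal to \<open>P j\<close> as m < j. The zero
  polynomial has degree 0, hence the separate disjunct, which also covers j = 0.\<close>

lemma orthogonal_to_lower_degree:
  fixes P :: "nat \<Rightarrow> real poly" and w :: "real \<Rightarrow> real"
  assumes deg: "\<And>j. degree (P j) = j" and nz: "\<And>j. P j \<noteq> 0"
    and orth: "\<And>i j. i \<noteq> j \<Longrightarrow> ((\<lambda>x. w x * (poly (P i) x * poly (P j) x)) has_integral 0) S"
    and d: "d = 0 \<or> degree d < j"
  shows "((\<lambda>x. w x * (poly d x * poly (P j) x)) has_integral 0) S"
  using d
proof (induction "degree d" arbitrary: d rule: less_induct)
  case less
  show ?case
  proof (cases "d = 0")
    case False
    define m where "m = degree d"
    define r where "r = lead_coeff d / lead_coeff (P m)"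
    define e where "e = d - smult r (P m)"
    have "m < j" using less.prems False by (simp add: m_def)
    have "coeff e m = 0"
      using nz[of m] deg[of m] by (simp add: e_def r_def m_def[symmetric] flip: leading_coeff_0_iff)
    moreover have "degree e \<le> m"
      unfolding e_def using degree_smult_le[of r "P m"] deg[of m]
      by (intro degree_diff_le) (auto simp: m_def)
    ultimately have e: "e = 0 \<or> degree e < m"
      using leading_coeff_0_iff[of e] le_neq_implies_less by fastforce
    have "((\<lambda>x. w x * (poly e x * poly (P j) x)) has_integral 0) S"
    proof (cases "e = 0")
      case False
      with e \<open>m < j\<close> show ?thesis by (intro less.hyps) (auto simp: m_def)
    qed simp
    from has_integral_add[OF this has_integral_mult_right[OF orth[of m j], of r]] \<open>m < j\<close>
    show ?thesis by (simp add: e_def algebra_simps)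
  qed simp
qed

text \<open>On [-1/2, 1/2], away from the endpoints, the weight is continuous and positive. A
  continuous nonnegative integrand with zero integral vanishes there, giving d infinitely many
  roots.\<close>

lemma poly_eq_0_if_weighted_square_integral_0:
  fixes d :: "real poly"
  assumes "((\<lambda>x. (1 - x) powr a * (1 + x) powr b * (poly d x * poly d x)) has_integral 0) {-1..1}"
    (is "(?f has_integral 0) _")
  shows "d = 0"
proof -
  have int: "?f integrable_on {-1/2..1/2}"
    by (rule integrable_on_subinterval[OF has_integral_integrable[OF assms]]) auto
  have nonneg: "?f x \<ge> 0" for x by simp
  have "integral {-1/2..1/2} ?f \<le> integral {-1..1} ?f"
    using int assms by (intro integral_subset_le) auto
  also have "\<dots> = 0" using assms by (rule integral_unique)
  finally have "integral {-1/2..1/2} ?f = 0"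
    using integral_nonneg[OF int] nonneg by (intro antisym) auto
  with integrable_integral[OF int] have "(?f has_integral 0) (cbox (-1/2) (1/2))"
    by simp
  moreover have "continuous_on (cbox (-1/2) (1/2)) ?f"
    by (auto intro!: continuous_intros)
  ultimately have "?f x = 0" if "x \<in> {-1/2..1/2}" for x
    using that by (intro has_integral_0_cbox_imp_0[of "-1/2" "1/2" ?f]) auto
  then have "{-1/2..1/2} \<subseteq> {x. poly d x = 0}"
    by (force simp: powr_def)
  then have "infinite {x. poly d x = 0}"
    by (rule infinite_super) (simp add: infinite_Icc)
  then show ?thesis
    using poly_roots_finite by blast
qed

lemma is_jacobi_family_unique:
  assumes ab: "a > -1" "b > -1" and P: "is_jacobi_family a b P" and Q: "is_jacobi_family a b Q"
  shows "P = Q"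
proof
  fix j
  have nz: "R i \<noteq> 0" if "is_jacobi_family a b R" for R i
    using that pochhammer_jacobi_lead_pos[OF ab, of i]
    unfolding is_jacobi_family_def by (metis divide_eq_0_iff fact_nonzero leading_coeff_0_iff
        less_irrefl mult_eq_0_iff power_eq_0_iff zero_neq_numeral)
  define d where "d = P j - Q j"
  have degs: "degree (P j) = j" "degree (Q j) = j"
    using P Q by (auto simp: is_jacobi_family_def)
  have "lead_coeff (P j) = lead_coeff (Q j)"
    using P Q unfolding is_jacobi_family_def by metis
  then have "coeff d j = 0" by (simp add: d_def degs)
  moreover have "degree d \<le> j" unfolding d_def by (intro degree_diff_le) (simp_all add: degs)
  ultimately have d: "d = 0 \<or> degree d < j"
    using leading_coeff_0_iff[of d] le_neq_implies_less by fastforce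
  have orth: "((\<lambda>x. (1 - x) powr a * (1 + x) powr b * (poly d x * poly (R j) x)) has_integral 0) {-1..1}"
    if "is_jacobi_family a b R" for R
  proof (rule orthogonal_to_lower_degree[OF _ nz[OF that] _ d])
    show "degree (R i) = i" for i
      using that by (simp add: is_jacobi_family_def)
    show "((\<lambda>x. (1 - x) powr a * (1 + x) powr b * (poly (R i) x * poly (R k) x))
        has_integral 0) {-1..1}" if "i \<noteq> k" for i k
      using \<open>is_jacobi_family a b R\<close> that by (simp add: is_jacobi_family_def)
  qed
  \<comment> \<open>\<open>d\<close> is orthogonal to both \<open>P j\<close> and
    \<open>Q j\<close>, hence to their difference, which is \<open>d\<close> itself.\<close>
  from has_integral_diff[OF orth[OF P] orth[OF Q]]
  have "((\<lambda>x. (1 - x) powr a * (1 + x) powr b * (poly d x * poly d x)) has_integral 0) {-1..1}"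
    by (simp add: d_def algebra_simps)
  then have "d = 0" by (rule poly_eq_0_if_weighted_square_integral_0)
  then show "P j = Q j" by (simp add: d_def)
qed

lemma jacobi_poly_eq_explicit:
  assumes "a > -1" "b > -1"
  shows "jacobi_poly a b = jacobi_explicit a b"
  unfolding jacobi_poly_def
  using is_jacobi_family_explicit[OF assms] is_jacobi_family_unique[OF assms] by blast

section \<open>Weights at the final time and regrouping of the expansion\<close>

lemma shifted_jacobi_final_time:
  assumes "a > -1" "b > -1" "\<Delta>t > 0"
  shows "shifted_jacobi a b \<Delta>t n j (real n * \<Delta>t) = pochhammer (a + 1) j / fact j"
proof -
  have "block_map \<Delta>t n (real n * \<Delta>t) = 1"
    using assms by (simp add: block_map_def field_simps)
  then show ?thesis
    by (simp add: shifted_jacobi_def jacobi_poly_eq_explicit[OF assms(1,2)] poly_jacobi_explicit_1)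
qed

text \<open>Uses Gamma(z + j) / Gamma(z) = (z)_j at z = a + 1, which is positive and so not a
  pole.\<close>

lemma Gamma_binomial_eq_pochhammer:
  fixes a :: real
  assumes "a > -1"
  shows "Gamma (real j + a + 1) / (Gamma (real j + 1) * Gamma (a + 1)) = pochhammer (a + 1) j / fact j"
proof -
  have "a + 1 \<notin> \<int>\<^sub>\<le>\<^sub>0"
    using assms by (auto elim!: nonpos_Ints_cases)
  then have "pochhammer (a + 1) j = Gamma (real j + a + 1) / Gamma (a + 1)"
    by (simp add: pochhammer_Gamma algebra_simps)
  moreover have "Gamma (real j + 1) = fact j"
    using Gamma_fact[of j, where 'a = real] by (simp add: add.commute)
  ultimately show ?thesis by simp
qed

text \<open>The finite index set need not be a rectangle, so the sum is grouped by the fibres of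
  \<open>snd\<close>, and the range of the inner sum depends on k.\<close>

lemma sum_pairs_by_snd:
  fixes g :: "'a \<Rightarrow> 'b \<Rightarrow> 'c :: semiring_0"
  assumes "finite I"
  shows "(\<Sum>(j, k)\<in>I. g j k * h k) = (\<Sum>k\<in>snd ` I. (\<Sum>j | (j, k) \<in> I. g j k) * h k)"
proof -
  have "(\<Sum>(j, k)\<in>I. g j k * h k) =
      (\<Sum>k\<in>snd ` I. \<Sum>z | z \<in> I \<and> snd z = k. case z of (j, k) \<Rightarrow> g j k * h k)"
    using assms by (intro sum.group[symmetric]) auto
  also have "\<dots> = (\<Sum>k\<in>snd ` I. \<Sum>j | (j, k) \<in> I. g j k * h k)"
    by (intro sum.cong refl sum.reindex_bij_witness[of _ "\<lambda>j. (j, _)" fst]) auto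
  finally show ?thesis
    by (simp add: sum_distrib_right)
qed

theorem lemma3p1:
  fixes \<Delta>t :: real and n :: nat and \<Omega> :: "(real ^ 'm) set"
    and p :: "nat \<Rightarrow> real \<Rightarrow> real"
    and K :: "'k set" and q :: "'k \<Rightarrow> real ^ 'm \<Rightarrow> real"
    and I :: "(nat \<times> 'k) set" and c :: "nat \<Rightarrow> 'k \<Rightarrow> real"
    and u :: "real \<Rightarrow> real ^ 'm \<Rightarrow> real"
  assumes "\<Delta>t > 0" and "n \<ge> 1"
    and "polynomial_basis_on UNIV p {(real n - 1) * \<Delta>t .. real n * \<Delta>t}"
    and "polynomial_basis_on K q \<Omega>"
    and "finite I" and "I \<subseteq> UNIV \<times> K"
    and "\<forall>t\<in>{(real n - 1) * \<Delta>t .. real n * \<Delta>t}. \<forall>x\<in>\<Omega>.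
           u t x = (\<Sum>(j, k)\<in>I. c j k * p j t * q k x)"
  shows
    "(\<forall>x\<in>\<Omega>. u (real n * \<Delta>t) x =
        (\<Sum>k\<in>snd ` I. (\<Sum>j | (j, k) \<in> I. c j k * p j (real n * \<Delta>t)) * q k x))
     \<and>
     (\<forall>a b. a > -1 \<longrightarrow> b > -1 \<longrightarrow>
        (\<forall>j. \<forall>t\<in>{(real n - 1) * \<Delta>t .. real n * \<Delta>t}. p j t = shifted_jacobi a b \<Delta>t n j t) \<longrightarrow>
        (\<forall>x\<in>\<Omega>.
           u (real n * \<Delta>t) x =
             (\<Sum>k\<in>snd ` I. (\<Sum>j | (j, k) \<in> I.
                Gamma (real j + a + 1) / (Gamma (real j + 1) * Gamma (a + 1)) * c j k) * q k x) \<and>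
           u (real n * \<Delta>t) x =
             (\<Sum>k\<in>snd ` I. (\<Sum>j | (j, k) \<in> I. pochhammer (a + 1) j / fact j * c j k) * q k x)))
     \<and>
     (\<forall>a b. a > -1 \<longrightarrow> b > -1 \<longrightarrow>
        (\<exists>w :: nat \<Rightarrow> real. \<forall>j.
           w j = Gamma (real j + a + 1) / (Gamma (real j + 1) * Gamma (a + 1)) \<and>
           w j = pochhammer (a + 1) j / fact j \<and>
           (\<forall>\<Delta>t' n'. \<Delta>t' > 0 \<longrightarrow> n' \<ge> 1 \<longrightarrow>
              shifted_jacobi a b \<Delta>t' n' j (real n' * \<Delta>t') = w j)))"
proof -
  let ?T = "real n * \<Delta>t"
  have T: "?T \<in> {(real n - 1) * \<Delta>t .. ?T}"
    using assms(1) by (simp add: algebra_simps)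
  have slice: "u ?T x = (\<Sum>k\<in>snd ` I. (\<Sum>j | (j, k) \<in> I. c j k * p j ?T) * q k x)"
    if "x \<in> \<Omega>" for x
    using assms(7) T that sum_pairs_by_snd[OF assms(5), of "\<lambda>j k. c j k * p j ?T" "\<lambda>k. q k x"]
    by auto
  have jacobi: "u ?T x =
      (\<Sum>k\<in>snd ` I. (\<Sum>j | (j, k) \<in> I. pochhammer (a + 1) j / fact j * c j k) * q k x)"
    if "a > -1" "b > -1" "x \<in> \<Omega>"
      and p: "\<forall>j. \<forall>t\<in>{(real n - 1) * \<Delta>t .. ?T}. p j t = shifted_jacobi a b \<Delta>t n j t"
    for a b x
  proof -
    have "p j ?T = pochhammer (a + 1) j / fact j" for j
      using p T shifted_jacobi_final_time[OF that(1,2) assms(1)] by metis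
    then show ?thesis
      using slice[OF \<open>x \<in> \<Omega>\<close>] by (simp add: mult.commute)
  qed
  show ?thesis
  proof (intro conjI allI impI ballI)
    fix a b :: real
    assume ab: "a > -1" "b > -1"
    show "\<exists>w :: nat \<Rightarrow> real. \<forall>j.
           w j = Gamma (real j + a + 1) / (Gamma (real j + 1) * Gamma (a + 1)) \<and>
           w j = pochhammer (a + 1) j / fact j \<and>
           (\<forall>\<Delta>t' n'. \<Delta>t' > 0 \<longrightarrow> n' \<ge> 1 \<longrightarrow>
              shifted_jacobi a b \<Delta>t' n' j (real n' * \<Delta>t') = w j)"
      \<comment> \<open>The witness is fixed before the step size and the block index are chosen,
        which is what independence from them means.\<close>
      using ab by (intro exI[of _ "\<lambda>j. pochhammer (a + 1) j / fact j"])
        (simp add: Gamma_binomial_eq_pochhammer shifted_jacobi_final_time)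
  qed (use slice jacobi in \<open>simp_all only: Gamma_binomial_eq_pochhammer\<close>)
qed

end
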